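(* Let $0<\theta\leq 1$, let $a\in\mathbb{R}\setminus\{0\}$, and let $\psi$ be a fractional wavelet. Then the operator $f\mapsto (L_\psi^\theta f)(\cdot,a)$ is a bounded operator from $H^1(\mathbb{R})$ to $H^1(\mathbb{R})$. Furthermore, for every $f\in H^1(\mathbb{R})$, $$\|(L_\psi^\theta f)(\cdot,a)\|_{H^1(\mathbb{R})}\leq\frac{|a|^{\frac{1}{2\theta}}}{\sqrt{C_{\psi,\theta}}}\,\|\psi\|_{L^1(\mathbb{R})}\,\|f\|_{H^1(\mathbb{R})}.$$
   Context: Functions are complex-valued on $\mathbb{R}$. For $0<\theta\leq1$, the fractional Fourier transform is $(\mathfrak{F}_\theta f)(\xi)=\int_{\mathbb{R}}e^{-i(\operatorname{sgn}\xi)|\xi|^{1/\theta}t}f(t)\,dt$. A fractional wavelet (of order $\theta$) is a non-zero function $\psi\in L^1(\mathbb{R})\cap L^2(\mathbb{R})$ with $C_{\psi,\theta}:=\int_{\mathbb{R}}\frac{|(\mathfrak{F}_\theta\psi)(\xi)|^2}{|\xi|}\,d\xi<\infty$. For $a\in\mathbb{R}\setminus\{0\}$, $b\in\mathbb{R}$, put $\psi_{a,b,\theta}(t)=\frac{1}{|a|^{1/(2\theta)}}\psi\left(\frac{t-b}{(\operatorname{sgn} a)|a|^{1/\theta}}\right)$. The continuous fractional wavelet transform (CFrWT) of $f$ is $(W_\psi^\theta f)(b,a)=\int_{\mathbb{R}}f(t)\overline{\psi_{a,b,\theta}(t)}\,dt$ whenever the integral is well-defined, and its normalized form is $L_\psi^\theta:=\frac{1}{\sqrt{C_{\psi,\theta}}}W_\psi^\theta$.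 For fixed $a$, $(L_\psi^\theta f)(\cdot,a)$ is regarded as a function of $b$ (defined almost everywhere). Convolution: $(f\star g)(x)=\int_{\mathbb{R}}f(u)g(x-u)\,du$. Hardy space: fix a Schwartz function $\eta$ with $\int_{\mathbb{R}}\eta(x)\,dx\neq0$ and put $\eta_t(x)=\frac1t\eta(\frac xt)$ for $t>0$. Then $H^1(\mathbb{R})=\{f\in L^1(\mathbb{R}):\int_{\mathbb{R}}\sup_{t>0}|(f\star\eta_t)(x)|\,dx<\infty\}$, with norm $\|f\|_{H^1(\mathbb{R})}=\int_{\mathbb{R}}\sup_{t>0}|(f\star\eta_t)(x)|\,dx$ (the same $\eta$ is used throughout). *)

theory Defs
  imports "HOL-Analysis.Analysis"
begin

text \<open>
  Functions on the real line are genuine functions, measurable in the sense of Lebesgue;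
  the identification of functions that agree almost everywhere is made explicit where it matters.
\<close>

definition L1_space :: "(real \<Rightarrow> complex) set" where
  "L1_space = {f. integrable lebesgue f}"

definition L2_space :: "(real \<Rightarrow> complex) set" where
  "L2_space = {f. f \<in> borel_measurable lebesgue \<and> integrable lebesgue (\<lambda>x. (cmod (f x))\<^sup>2)}"

definition L1_norm :: "(real \<Rightarrow> complex) \<Rightarrow> real" where
  "L1_norm f = (LINT x|lebesgue. cmod (f x))"

definition convol :: "(real \<Rightarrow> complex) \<Rightarrow> (real \<Rightarrow> complex) \<Rightarrow> real \<Rightarrow> complex" where
  "convol f g x = (LINT u|lebesgue. f u * g (x - u))"

definition frac_fourier :: "real \<Rightarrow> (real \<Rightarrow> complex) \<Rightarrow> real \<Rightarrow> complex" where
  "frac_fourier \<theta> f \<xi> =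
     (LINT t|lebesgue. exp (- \<i> * of_real (sgn \<xi> * \<bar>\<xi>\<bar> powr (1 / \<theta>) * t)) * f t)"

definition admissibility_const :: "(real \<Rightarrow> complex) \<Rightarrow> real \<Rightarrow> real" where
  "admissibility_const \<psi> \<theta> = (LINT \<xi>|lebesgue. (cmod (frac_fourier \<theta> \<psi> \<xi>))\<^sup>2 / \<bar>\<xi>\<bar>)"

text \<open>
  Non-zero means non-zero as an element of \<open>L\<^sup>1\<close>. Integrability of the non-negative integrand
  expresses that the admissibility constant is finite.
\<close>

definition fractional_wavelet :: "real \<Rightarrow> (real \<Rightarrow> complex) \<Rightarrow> bool" where
  "fractional_wavelet \<theta> \<psi> \<longleftrightarrow>
     \<psi> \<in> L1_space \<and> \<psi> \<in> L2_space \<and>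
     \<not> (AE x in lebesgue. \<psi> x = 0) \<and>
     integrable lebesgue (\<lambda>\<xi>. (cmod (frac_fourier \<theta> \<psi> \<xi>))\<^sup>2 / \<bar>\<xi>\<bar>)"

definition wavelet_atom :: "(real \<Rightarrow> complex) \<Rightarrow> real \<Rightarrow> real \<Rightarrow> real \<Rightarrow> real \<Rightarrow> complex" where
  "wavelet_atom \<psi> a b \<theta> t =
     of_real (1 / \<bar>a\<bar> powr (1 / (2 * \<theta>))) * \<psi> ((t - b) / (sgn a * \<bar>a\<bar> powr (1 / \<theta>)))"

text \<open>The transform is undefined at \<open>(b, a)\<close> where the following predicate fails; there the
  Bochner integral below takes the value 0.\<close>

definition cfrwt_defined :: "(real \<Rightarrow> complex) \<Rightarrow> real \<Rightarrow> (real \<Rightarrow> complex) \<Rightarrow> real \<Rightarrow> real \<Rightarrow> bool" where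
  "cfrwt_defined \<psi> \<theta> f b a \<longleftrightarrow> integrable lebesgue (\<lambda>t. f t * cnj (wavelet_atom \<psi> a b \<theta> t))"

definition cfrwt :: "(real \<Rightarrow> complex) \<Rightarrow> real \<Rightarrow> (real \<Rightarrow> complex) \<Rightarrow> real \<Rightarrow> real \<Rightarrow> complex" where
  "cfrwt \<psi> \<theta> f b a = (LINT t|lebesgue. f t * cnj (wavelet_atom \<psi> a b \<theta> t))"

definition normalized_cfrwt ::
    "(real \<Rightarrow> complex) \<Rightarrow> real \<Rightarrow> (real \<Rightarrow> complex) \<Rightarrow> real \<Rightarrow> real \<Rightarrow> complex" where
  "normalized_cfrwt \<psi> \<theta> f b a =
     of_real (1 / sqrt (admissibility_const \<psi> \<theta>)) * cfrwt \<psi> \<theta> f b a"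

definition vderiv :: "(real \<Rightarrow> complex) \<Rightarrow> real \<Rightarrow> complex" where
  "vderiv f = (\<lambda>x. vector_derivative f (at x))"

definition schwartz :: "(real \<Rightarrow> complex) \<Rightarrow> bool" where
  "schwartz \<eta> \<longleftrightarrow>
     (\<forall>n x. (vderiv ^^ n) \<eta> differentiable (at x)) \<and>
     (\<forall>m n. bounded (range (\<lambda>x. of_real (x ^ m) * (vderiv ^^ n) \<eta> x)))"

definition dilate :: "(real \<Rightarrow> complex) \<Rightarrow> real \<Rightarrow> real \<Rightarrow> complex" where
  "dilate \<eta> t x = of_real (1 / t) * \<eta> (x / t)"

definition maximal_fun :: "(real \<Rightarrow> complex) \<Rightarrow> (real \<Rightarrow> complex) \<Rightarrow> real \<Rightarrow> ennreal" where
  "maximal_fun \<eta> f x = (SUP t\<in>{0<..}. ennreal (cmod (convol f (dilate \<eta> t) x)))"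

definition H1_space :: "(real \<Rightarrow> complex) \<Rightarrow> (real \<Rightarrow> complex) set" where
  "H1_space \<eta> = {f \<in> L1_space. (\<integral>\<^sup>+ x. maximal_fun \<eta> f x \<partial>lebesgue) < \<infinity>}"

definition H1_norm :: "(real \<Rightarrow> complex) \<Rightarrow> (real \<Rightarrow> complex) \<Rightarrow> real" where
  "H1_norm \<eta> f = enn2real (\<integral>\<^sup>+ x. maximal_fun \<eta> f x \<partial>lebesgue)"

text \<open>
  Bounded linear operators between spaces of functions taken modulo almost everywhere equality:
  \<open>T\<close> descends to equivalence classes, is linear on them, maps \<open>X\<close> into \<open>Y\<close>, and is bounded.
\<close>

definition bounded_operator_AE ::
    "(real \<Rightarrow> complex) set \<Rightarrow> ((real \<Rightarrow> complex) \<Rightarrow> real) \<Rightarrow>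
     (real \<Rightarrow> complex) set \<Rightarrow> ((real \<Rightarrow> complex) \<Rightarrow> real) \<Rightarrow>
     ((real \<Rightarrow> complex) \<Rightarrow> real \<Rightarrow> complex) \<Rightarrow> bool" where
  "bounded_operator_AE X NX Y NY T \<longleftrightarrow>
     (\<forall>f\<in>X. T f \<in> Y) \<and>
     (\<forall>f\<in>X. \<forall>g\<in>X. (AE x in lebesgue. f x = g x) \<longrightarrow> (AE x in lebesgue. T f x = T g x)) \<and>
     (\<forall>f\<in>X. \<forall>g\<in>X. AE x in lebesgue. T (\<lambda>y. f y + g y) x = T f x + T g x) \<and>
     (\<forall>c. \<forall>f\<in>X. AE x in lebesgue. T (\<lambda>y. c * f y) x = c * T f x) \<and>
     (\<exists>K. \<forall>f\<in>X. NY (T f) \<le> K * NX f)"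

end

theory Submission
  imports Defs
begin

text \<open>
  After the substitution \<open>t = b + s u\<close> with \<open>s = sgn a * \<bar>a\<bar> powr (1 / \<theta>)\<close>, the transform is a
  multiple of a superposition of translates of \<open>f\<close> with weight \<open>cnj \<psi>\<close>. Convolution with
  \<open>\<eta>\<^sub>t\<close> commutes with translations and, by Fubini, with the superposition, so the maximal function of
  the transform at \<open>x\<close> is bounded by the same superposition, with weight \<open>\<bar>\<psi>\<bar>\<close>, of the values at
  \<open>x + s u\<close> of the maximal function of \<open>f\<close>. Tonelli's theorem and translation invariance give the estimate.
\<close>

section \<open>Borel representatives of Lebesgue measurable functions\<close>

text \<open>Fubini for \<open>f (b + s * u)\<close> requires joint measurability in
  \<open>(u, b)\<close>, which is immediate when \<open>f\<close> is Borel. Hence the passage to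
  representatives, built from the real and imaginary parts separately.\<close>

lemma integrable_lebesgue_ex_lborel:
  fixes f :: "real \<Rightarrow> complex"
  assumes f: "integrable lebesgue f"
  obtains g where "integrable lborel g" "AE x in lebesgue. f x = g x"
proof -
  have [measurable]: "f \<in> borel_measurable lebesgue"
    using f by simp
  obtain u where u [measurable]: "u \<in> borel_measurable lborel" and "AE x in lborel. Re (f x) = u x"
    using completion_ex_borel_measurable_real[of "\<lambda>x. Re (f x)" lborel] by auto
  moreover obtain v where v [measurable]: "v \<in> borel_measurable lborel" and "AE x in lborel. Im (f x) = v x"
    using completion_ex_borel_measurable_real[of "\<lambda>x. Im (f x)" lborel] by auto
  ultimately have "AE x in lborel. f x = Complex (u x) (v x)"
    by (auto simp: complex_eq_iff)
  then have ae: "AE x in lebesgue. f x = Complex (u x) (v x)"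
    by (rule AE_completion)
  have meas: "(\<lambda>x. Complex (u x) (v x)) \<in> borel_measurable lborel"
    unfolding Complex_eq by measurable
  have "integrable lebesgue (\<lambda>x. Complex (u x) (v x))"
    by (rule integrable_cong_AE_imp[OF f]) (use ae measurable_completion[OF meas] in auto)
  then have "integrable lborel (\<lambda>x. Complex (u x) (v x))"
    using integrable_completion[OF meas] by simp
  with ae show thesis
    using that by blast
qed

text \<open>The exceptional set of \<open>P\<close> need not be Borel, so it is first enlarged to a
  Borel null set \<open>N\<close>; the affine substitution then applies to the Borel predicate of
  avoiding \<open>N\<close>.\<close>

lemma AE_lebesgue_affine:
  fixes c t :: real
  assumes "AE x in lebesgue. P x" and c: "c \<noteq> 0"
  shows "AE x in lebesgue. P (t + c * x)"
proof -
  have "AE x in lborel. P x"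
    using assms(1) by (simp add: AE_completion_iff)
  then obtain N where N: "{x. \<not> P x} \<subseteq> N" "emeasure lborel N = 0" "N \<in> sets borel"
    by (auto elim!: AE_E)
  then have "AE x in lborel. x \<notin> N"
    by (intro AE_not_in null_setsI) auto
  moreover have "Measurable.pred borel (\<lambda>x. x \<notin> N)"
    using N(3) by measurable
  ultimately have "AE x in lborel. t + c * x \<notin> N"
    using AE_borel_affine[OF c, of "\<lambda>x. x \<notin> N" t] by simp
  then have "AE x in lborel. P (t + c * x)"
    by eventually_elim (use N(1) in auto)
  then show ?thesis
    by (rule AE_completion)
qed

text \<open>The set of \<open>u\<close> where \<open>f\<close> and \<open>g\<close> differ does not
  depend on \<open>x\<close>, so the equality holds at every point \<open>x\<close>. Maximal
  functions can therefore later be identified everywhere, although they are suprema over uncountably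
  many \<open>t\<close>.\<close>

lemma convol_cong_AE:
  assumes f: "f \<in> borel_measurable lebesgue" and g: "g \<in> borel_measurable borel"
    and ae: "AE x in lebesgue. f x = g x" and k [measurable]: "k \<in> borel_measurable borel"
  shows "convol f k x = (LINT u|lborel. g u * k (x - u))"
proof -
  have k': "(\<lambda>u. k (x - u)) \<in> borel_measurable lebesgue"
    by (intro measurable_completion) simp
  have g': "(\<lambda>u. g u * k (x - u)) \<in> borel_measurable lborel"
    using g by simp
  have "convol f k x = (LINT u|lebesgue. g u * k (x - u))"
    unfolding convol_def
    by (rule integral_cong_AE) (use ae f k' measurable_completion[OF g'] in auto)
  also have "\<dots> = (LINT u|lborel. g u * k (x - u))"
    using integral_completion[OF g'] by simp
  finally show ?thesis .
qed

section \<open>Convolutions and superpositions of translates\<close>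

text \<open>Dominated convergence along sequences, with dominating function
  \<open>cmod (g u) * B\<close>. This continuity is the source of the lower semicontinuity of the
  maximal function.\<close>

lemma continuous_convolution:
  fixes g k :: "real \<Rightarrow> complex"
  assumes g: "integrable lborel g" and k: "continuous_on UNIV k" and B: "\<And>x. cmod (k x) \<le> B"
  shows "continuous_on UNIV (\<lambda>x. LINT u|lborel. g u * k (x - u))"
proof -
  have [measurable]: "k \<in> borel_measurable borel" "g \<in> borel_measurable borel"
    using k g borel_measurable_continuous_onI by auto
  have cont: "isCont k x" for x
    using k by (simp add: continuous_on_eq_continuous_at)
  have bound: "cmod (g u * k y) \<le> cmod (g u) * B" for u y
    by (simp add: norm_mult mult_left_mono B)
  have "((\<lambda>n. LINT u|lborel. g u * k (X n - u)) \<longlongrightarrow> (LINT u|lborel. g u * k (x - u))) sequentially"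
    if "X \<longlonglongrightarrow> x" for X x
  proof (rule integral_dominated_convergence[where w="\<lambda>u. cmod (g u) * B"])
    show "AE u in lborel. (\<lambda>n. g u * k (X n - u)) \<longlonglongrightarrow> g u * k (x - u)"
      by (intro AE_I2 tendsto_intros isCont_tendsto_compose[OF cont] that)
  qed (use g bound in auto)
  then show ?thesis
    by (simp add: continuous_on_sequentially o_def)
qed

text \<open>Integrating in \<open>b\<close> first is what makes this work: each slice is a translate
  of \<open>f\<close>, so its L1 norm is \<open>cmod (g u)\<close> times that of \<open>f\<close>,
  which is integrable in \<open>u\<close>.\<close>

lemma integrable_convolution_kernel:
  fixes f g :: "real \<Rightarrow> complex" and s :: real
  assumes f: "integrable lborel f" and g: "integrable lborel g"
  shows "integrable (lborel \<Otimes>\<^sub>M lborel) (\<lambda>(u, b). g u * f (b + s * u))"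
proof (rule lborel_pair.Fubini_integrable)
  have [measurable]: "f \<in> borel_measurable borel" "g \<in> borel_measurable borel"
    using f g by auto
  show "(\<lambda>(u, b). g u * f (b + s * u)) \<in> borel_measurable (lborel \<Otimes>\<^sub>M lborel)"
    by measurable
  have shift: "integrable lborel (\<lambda>b. f (b + s * u))" for u
    using lborel_integrable_real_affine[OF f, of 1 "s * u"] by (simp add: add.commute)
  have "(LINT b|lborel. cmod (f (b + s * u))) = (LINT b|lborel. cmod (f b))" for u
    using lborel_integral_real_affine[of 1 "\<lambda>b. cmod (f b)" "s * u"] by (simp add: add.commute)
  then show "integrable lborel (\<lambda>u. LINT b|lborel. cmod (case (u, b) of (u, b) \<Rightarrow> g u * f (b + s * u)))"
    using g by (simp add: norm_mult)
  show "AE u in lborel. integrable lborel (\<lambda>b. case (u, b) of (u, b) \<Rightarrow> g u * f (b + s * u))"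
    using shift by simp
qed

text \<open>For individual \<open>b\<close> the integral over \<open>u\<close> may fail to exist and
  then takes the value 0; by Fubini this happens only on a null set.\<close>

lemma superposition_integrable:
  fixes f g :: "real \<Rightarrow> complex" and s :: real
  assumes f: "integrable lborel f" and g: "integrable lborel g"
  shows "AE b in lborel. integrable lborel (\<lambda>u. g u * f (b + s * u))"
    and "integrable lborel (\<lambda>b. LINT u|lborel. g u * f (b + s * u))"
  using lborel_pair.AE_integrable_snd[OF integrable_convolution_kernel[OF f g, of s]]
    lborel_pair.integrable_snd[OF integrable_convolution_kernel[OF f g, of s]]
  by simp_all

lemma convolution_superposition:
  fixes f g k :: "real \<Rightarrow> complex" and s :: real
  assumes f: "integrable lborel f" and g: "integrable lborel g"
    and k [measurable]: "k \<in> borel_measurable borel" and B: "\<And>x. cmod (k x) \<le> B"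
  shows "(LINT b|lborel. (LINT u|lborel. g u * f (b + s * u)) * k (x - b)) =
         (LINT u|lborel. g u * (LINT b|lborel. f b * k (x + s * u - b)))"
proof -
  have [measurable]: "f \<in> borel_measurable borel" "g \<in> borel_measurable borel"
    using f g by auto
  let ?F = "\<lambda>u b. g u * f (b + s * u) * k (x - b)"
  \<comment> \<open>Since \<open>k\<close> is bounded, the integrand with the extra factor
    \<open>k (x - b)\<close> is dominated by a multiple of the integrable kernel, and the two
    integrations may be exchanged.\<close>
  have "integrable (lborel \<Otimes>\<^sub>M lborel) (\<lambda>p. B *\<^sub>R (\<lambda>(u, b). g u * f (b + s * u)) p)"
    using integrable_convolution_kernel[OF f g, of s] by (intro integrable_scaleR_right)
  then have int: "integrable (lborel \<Otimes>\<^sub>M lborel) (\<lambda>(u, b). ?F u b)"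
  proof (rule Bochner_Integration.integrable_bound)
    show "AE p in lborel \<Otimes>\<^sub>M lborel. cmod (case p of (u, b) \<Rightarrow> ?F u b)
        \<le> cmod (B *\<^sub>R (\<lambda>(u, b). g u * f (b + s * u)) p)"
    proof (intro AE_I2, clarsimp simp: norm_mult)
      fix u b
      have "cmod (k (x - b)) \<le> \<bar>B\<bar>"
        using B[of "x - b"] by linarith
      then show "cmod (g u) * cmod (f (b + s * u)) * cmod (k (x - b))
          \<le> \<bar>B\<bar> * (cmod (g u) * cmod (f (b + s * u)))"
        by (metis mult.commute mult_left_mono norm_ge_zero norm_mult)
    qed
  qed measurable
  have "(LINT b|lborel. (LINT u|lborel. g u * f (b + s * u)) * k (x - b)) =
        (LINT b|lborel. LINT u|lborel. ?F u b)"
    by simp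
  also have "\<dots> = (LINT u|lborel. LINT b|lborel. ?F u b)"
    by (rule lborel_pair.Fubini_integral[OF int])
  also have "\<dots> = (LINT u|lborel. g u * (LINT b|lborel. f b * k (x + s * u - b)))"
  proof (rule Bochner_Integration.integral_cong[OF refl])
    fix u
    \<comment> \<open>Replacing \<open>b\<close> by \<open>b + s * u\<close> moves the translation
      from \<open>f\<close> to the evaluation point of the convolution.\<close>
    have "(LINT b|lborel. f b * k (x + s * u - b)) =
        (LINT b|lborel. f (b + s * u) * k (x - b))"
      using lborel_integral_real_affine[of 1 "\<lambda>b. f b * k (x + s * u - b)" "s * u"]
      by (simp add: algebra_simps)
    then show "(LINT b|lborel. ?F u b) = g u * (LINT b|lborel. f b * k (x + s * u - b))"
      by (simp add: mult.assoc)
  qed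
  finally show ?thesis .
qed

section \<open>Continuity and boundedness of Schwartz functions and their dilates\<close>

lemma schwartz_imp_continuous_on: "schwartz \<eta> \<Longrightarrow> continuous_on UNIV \<eta>"
  unfolding schwartz_def
  by (intro continuous_at_imp_continuous_on ballI differentiable_imp_continuous_within)
    (metis funpow_0)

lemma schwartz_imp_bounded:
  assumes "schwartz \<eta>"
  obtains B where "\<And>x. cmod (\<eta> x) \<le> B"
proof -
  have "bounded (range (\<lambda>x. of_real (x ^ 0) * (vderiv ^^ 0) \<eta> x))"
    using assms unfolding schwartz_def by blast
  then show thesis
    using that by (auto simp: bounded_iff)
qed

lemma continuous_on_dilate:
  assumes "continuous_on UNIV \<eta>"
  shows "continuous_on UNIV (dilate \<eta> t)"
proof -
  have "continuous_on UNIV (\<lambda>x. \<eta> (inverse t * x))"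
    by (rule continuous_on_compose2[OF assms]) (auto intro!: continuous_intros)
  then show ?thesis
    unfolding dilate_def by (auto intro!: continuous_intros simp: divide_inverse mult.commute)
qed

lemma dilate_bounded:
  assumes "\<And>x. cmod (\<eta> x) \<le> B"
  shows "cmod (dilate \<eta> t x) \<le> \<bar>1 / t\<bar> * B"
  unfolding dilate_def norm_mult norm_of_real by (intro mult_left_mono assms) simp

section \<open>The maximal function and its behaviour under superposition\<close>

lemma maximal_fun_cong_AE:
  assumes "f \<in> borel_measurable lebesgue" "g \<in> borel_measurable borel"
    and "AE x in lebesgue. f x = g x" and "continuous_on UNIV \<eta>"
  shows "maximal_fun \<eta> f = maximal_fun \<eta> g"
proof -
  have d: "dilate \<eta> t \<in> borel_measurable borel" for t
    using continuous_on_dilate[OF assms(4)] by (rule borel_measurable_continuous_onI)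
  have g: "g \<in> borel_measurable lebesgue"
    using assms(2) by (intro measurable_completion) simp
  have "convol f (dilate \<eta> t) x = convol g (dilate \<eta> t) x" for t x
    by (simp only: convol_cong_AE[OF assms(1-3) d] convol_cong_AE[OF g assms(2) AE_I2[OF refl] d])
  then show ?thesis
    by (simp add: maximal_fun_def fun_eq_iff)
qed

text \<open>The maximal function is a supremum of uncountably many functions; it is measurable because these
  are continuous, so that it is lower semicontinuous.\<close>

lemma borel_measurable_maximal_fun:
  assumes g: "integrable lborel g" and \<eta>: "schwartz \<eta>"
  shows "maximal_fun \<eta> g \<in> borel_measurable borel"
proof (rule borel_measurableI_greater)
  fix y :: ennreal
  obtain B where B: "\<And>x. cmod (\<eta> x) \<le> B"
    using schwartz_imp_bounded[OF \<eta>] by blast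
  have gm: "g \<in> borel_measurable borel" and gl: "g \<in> borel_measurable lebesgue"
    using g by (auto intro: measurable_completion)
  have d: "continuous_on UNIV (dilate \<eta> t)" for t
    using schwartz_imp_continuous_on[OF \<eta>] by (rule continuous_on_dilate)
  have "continuous_on UNIV (\<lambda>x. ennreal (cmod (convol g (dilate \<eta> t) x)))" for t
    unfolding convol_cong_AE[OF gl gm AE_I2[OF refl] borel_measurable_continuous_onI[OF d]]
    by (intro continuous_on_ennreal continuous_on_norm
        continuous_convolution[OF g d dilate_bounded[where B=B]] B)
  then have "open ((\<lambda>x. ennreal (cmod (convol g (dilate \<eta> t) x))) -` {y<..})" for t
    by (intro open_vimage) auto
  then have "open (\<Union>t\<in>{0<..}. (\<lambda>x. ennreal (cmod (convol g (dilate \<eta> t) x))) -` {y<..})"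
    by blast
  also have "(\<Union>t\<in>{0<..}. (\<lambda>x. ennreal (cmod (convol g (dilate \<eta> t) x))) -` {y<..}) =
      {x \<in> space borel. y < maximal_fun \<eta> g x}"
    by (auto simp: maximal_fun_def less_SUP_iff)
  finally show "{x \<in> space borel. y < maximal_fun \<eta> g x} \<in> sets borel"
    by (rule borel_open)
qed

text \<open>For each \<open>t\<close> the convolution of the superposition is the superposition of
  the convolutions of \<open>f\<close> at the points \<open>x + s * u\<close>. Each of these is at
  most the maximal function there, a bound independent of \<open>t\<close>.\<close>

lemma maximal_fun_superposition_le:
  assumes f: "integrable lborel f" and g: "integrable lborel g" and \<eta>: "schwartz \<eta>"
  shows "maximal_fun \<eta> (\<lambda>b. LINT u|lborel. g u * f (b + s * u)) x \<le>
    (\<integral>\<^sup>+u. ennreal (cmod (g u)) * maximal_fun \<eta> f (x + s * u) \<partial>lborel)"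
  unfolding maximal_fun_def
proof (rule SUP_least)
  fix t :: real assume t: "t \<in> {0<..}"
  define h where "h = (\<lambda>b. LINT u|lborel. g u * f (b + s * u))"
  obtain B where B: "\<And>x. cmod (\<eta> x) \<le> B"
    using schwartz_imp_bounded[OF \<eta>] by blast
  have d: "dilate \<eta> t \<in> borel_measurable borel"
    by (intro borel_measurable_continuous_onI continuous_on_dilate schwartz_imp_continuous_on \<eta>)
  have conv: "convol k (dilate \<eta> t) y = (LINT b|lborel. k b * dilate \<eta> t (y - b))"
    if "integrable lborel k" for k y
    using that by (intro convol_cong_AE d measurable_completion) auto
  have "convol h (dilate \<eta> t) x = (LINT b|lborel. h b * dilate \<eta> t (x - b))"
    unfolding h_def by (intro conv superposition_integrable f g)
  also have "\<dots> = (LINT u|lborel. g u * (LINT b|lborel. f b * dilate \<eta> t (x + s * u - b)))"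
    unfolding h_def by (intro convolution_superposition[OF f g d dilate_bounded[where B=B]] B)
  also have "\<dots> = (LINT u|lborel. g u * convol f (dilate \<eta> t) (x + s * u))"
    by (simp add: conv[OF f])
  finally have eq: "convol h (dilate \<eta> t) x = \<dots>" .
  have "ennreal (cmod (convol h (dilate \<eta> t) x))
      \<le> (\<integral>\<^sup>+u. ennreal (cmod (g u * convol f (dilate \<eta> t) (x + s * u))) \<partial>lborel)"
    \<comment> \<open>If the integrand is not integrable, the Bochner integral on the left is 0 and
      the bound is trivial.\<close>
    unfolding eq
    by (cases "integrable lborel (\<lambda>u. g u * convol f (dilate \<eta> t) (x + s * u))")
      (auto intro: integral_norm_bound_ennreal simp: not_integrable_integral_eq)
  also have "\<dots> \<le> (\<integral>\<^sup>+u. ennreal (cmod (g u)) *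
      (SUP t\<in>{0<..}. ennreal (cmod (convol f (dilate \<eta> t) (x + s * u)))) \<partial>lborel)"
    using t by (intro nn_integral_mono) (auto simp: norm_mult ennreal_mult intro!: mult_left_mono SUP_upper)
  finally show "ennreal (cmod (convol (\<lambda>b. LINT u|lborel. g u * f (b + s * u)) (dilate \<eta> t) x)) \<le> \<dots>"
    by (simp add: h_def)
qed

text \<open>Tonelli's theorem, made applicable by the Borel measurability of
  \<open>maximal_fun \<eta> f\<close>, puts the integral over \<open>x\<close> inside; by
  translation invariance its value does not depend on \<open>u\<close> and factors out.\<close>

lemma nn_integral_maximal_fun_superposition_le:
  assumes f: "integrable lborel f" and g: "integrable lborel g" and \<eta>: "schwartz \<eta>"
  shows "(\<integral>\<^sup>+x. maximal_fun \<eta> (\<lambda>b. LINT u|lborel. g u * f (b + s * u)) x \<partial>lborel) \<le>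
    ennreal (LINT u|lborel. cmod (g u)) * (\<integral>\<^sup>+x. maximal_fun \<eta> f x \<partial>lborel)"
proof -
  have [measurable]: "g \<in> borel_measurable borel" "maximal_fun \<eta> f \<in> borel_measurable borel"
    using g borel_measurable_maximal_fun[OF f \<eta>] by auto
  have "(\<integral>\<^sup>+x. maximal_fun \<eta> (\<lambda>b. LINT u|lborel. g u * f (b + s * u)) x \<partial>lborel) \<le>
      (\<integral>\<^sup>+x. \<integral>\<^sup>+u. ennreal (cmod (g u)) * maximal_fun \<eta> f (x + s * u) \<partial>lborel \<partial>lborel)"
    by (intro nn_integral_mono maximal_fun_superposition_le f g \<eta>)
  also have "\<dots> = (\<integral>\<^sup>+u. \<integral>\<^sup>+x. ennreal (cmod (g u)) * maximal_fun \<eta> f (x + s * u) \<partial>lborel \<partial>lborel)"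
    by (rule lborel_pair.Fubini') measurable
  also have "\<dots> = (\<integral>\<^sup>+u. ennreal (cmod (g u)) * (\<integral>\<^sup>+x. maximal_fun \<eta> f x \<partial>lborel) \<partial>lborel)"
  proof (rule nn_integral_cong)
    fix u
    have "(\<integral>\<^sup>+x. maximal_fun \<eta> f (x + s * u) \<partial>lborel) = (\<integral>\<^sup>+x. maximal_fun \<eta> f x \<partial>lborel)"
      using nn_integral_real_affine[of "maximal_fun \<eta> f" 1 "s * u"] by (simp add: add.commute)
    then show "(\<integral>\<^sup>+x. ennreal (cmod (g u)) * maximal_fun \<eta> f (x + s * u) \<partial>lborel) =
        ennreal (cmod (g u)) * (\<integral>\<^sup>+x. maximal_fun \<eta> f x \<partial>lborel)"
      by (subst nn_integral_cmult) auto
  qed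
  also have "\<dots> = (\<integral>\<^sup>+u. ennreal (cmod (g u)) \<partial>lborel) * (\<integral>\<^sup>+x. maximal_fun \<eta> f x \<partial>lborel)"
    by (rule nn_integral_multc) measurable
  also have "(\<integral>\<^sup>+u. ennreal (cmod (g u)) \<partial>lborel) = ennreal (LINT u|lborel. cmod (g u))"
    by (intro nn_integral_eq_integral integrable_norm g) simp
  finally show ?thesis .
qed

lemma maximal_fun_cmult: "maximal_fun \<eta> (\<lambda>x. c * f x) x = ennreal (cmod c) * maximal_fun \<eta> f x"
proof -
  have "convol (\<lambda>x. c * f x) k y = c * convol f k y" for k y
    by (simp add: convol_def mult.assoc)
  then show ?thesis
    by (simp add: maximal_fun_def norm_mult ennreal_mult SUP_mult_left_ennreal)
qed

section \<open>The wavelet transform as a superposition of translates\<close>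

text \<open>The substitution \<open>t = b + s * u\<close> has Jacobian
  \<open>\<bar>s\<bar> = \<bar>a\<bar> powr (1 / \<theta>)\<close>, the square of the normalizing
  factor in the denominator of the atom; one such factor survives in front. The representatives do
  not depend on \<open>b\<close>, so both claims hold for every \<open>b\<close>.\<close>

lemma cfrwt_superposition:
  fixes \<psi> f :: "real \<Rightarrow> complex" and \<theta> a :: real
  defines "s \<equiv> sgn a * \<bar>a\<bar> powr (1 / \<theta>)"
  assumes a: "a \<noteq> 0" and f: "f \<in> borel_measurable lebesgue" and f': "f' \<in> borel_measurable borel"
    and ff': "AE x in lebesgue. f x = f' x"
    and \<psi>: "integrable lebesgue \<psi>" and \<psi>': "\<psi>' \<in> borel_measurable borel"
    and \<psi>\<psi>': "AE x in lebesgue. \<psi> x = \<psi>' x"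
  shows "cfrwt_defined \<psi> \<theta> f b a \<longleftrightarrow> integrable lborel (\<lambda>u. cnj (\<psi>' u) * f' (b + s * u))"
    and "cfrwt \<psi> \<theta> f b a =
      of_real (\<bar>a\<bar> powr (1 / (2 * \<theta>))) * (LINT u|lborel. cnj (\<psi>' u) * f' (b + s * u))"
proof -
  define r where "r = \<bar>a\<bar> powr (1 / (2 * \<theta>))"
  have r: "r > 0" and s: "s \<noteq> 0" and abs_s: "\<bar>s\<bar> = r * r"
    using a by (auto simp: r_def s_def abs_mult sgn_real_def powr_add[symmetric] field_simps)
  define F where "F = (\<lambda>t. of_real (1 / r) * (f' t * cnj (\<psi>' ((t - b) / s))))"
  have [measurable]: "cnj \<in> borel_measurable borel"
    by (intro borel_measurable_continuous_onI continuous_intros)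
  have F [measurable]: "F \<in> borel_measurable borel"
    unfolding F_def using f' \<psi>' by measurable
  have aff: "(t - b) / s = - b / s + (1 / s) * t" for t
    by (simp add: diff_divide_distrib)
  have inv: "1 / s \<noteq> 0"
    using s by simp
  have atom: "y * cnj (wavelet_atom \<psi> a b \<theta> t) = of_real (1 / r) * (y * cnj (\<psi> ((t - b) / s)))" for y t
    by (simp add: wavelet_atom_def r_def s_def)
  \<comment> \<open>Lebesgue measurability of the rescaled wavelet is read off from its
    integrability, which affine substitutions preserve.\<close>
  have "integrable lebesgue (\<lambda>t. \<psi> ((t - b) / s))"
    unfolding aff by (rule lebesgue_integrable_real_affine[OF \<psi> inv])
  then have m: "(\<lambda>t. f t * cnj (wavelet_atom \<psi> a b \<theta> t)) \<in> borel_measurable lebesgue"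
    unfolding atom using f by (auto dest!: borel_measurable_integrable)
  have FL: "F \<in> borel_measurable lebesgue"
    using F by (intro measurable_completion) simp
  have "AE t in lebesgue. \<psi> ((t - b) / s) = \<psi>' ((t - b) / s)"
    unfolding aff by (rule AE_lebesgue_affine[OF \<psi>\<psi>' inv])
  with ff' have ae: "AE t in lebesgue. f t * cnj (wavelet_atom \<psi> a b \<theta> t) = F t"
    by eventually_elim (simp only: atom F_def)
  have F_aff: "F (b + s * u) = of_real (1 / r) * (cnj (\<psi>' u) * f' (b + s * u))" for u
    using s by (simp add: F_def)
  have "cfrwt_defined \<psi> \<theta> f b a \<longleftrightarrow> integrable lborel F"
    unfolding cfrwt_defined_def using integrable_cong_AE[OF m FL ae] integrable_completion[of F lborel] by simp
  also have "\<dots> \<longleftrightarrow> integrable lborel (\<lambda>u. F (b + s * u))"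
    by (rule lborel_integrable_real_affine_iff[OF s, symmetric])
  also have "\<dots> \<longleftrightarrow> integrable lborel (\<lambda>u. cnj (\<psi>' u) * f' (b + s * u))"
  proof
    assume "integrable lborel (\<lambda>u. F (b + s * u))"
    then have "integrable lborel (\<lambda>u. of_real r * F (b + s * u))"
      by (rule integrable_mult_right)
    then show "integrable lborel (\<lambda>u. cnj (\<psi>' u) * f' (b + s * u))"
      unfolding F_aff using r by simp
  next
    assume "integrable lborel (\<lambda>u. cnj (\<psi>' u) * f' (b + s * u))"
    then show "integrable lborel (\<lambda>u. F (b + s * u))"
      unfolding F_aff by (rule integrable_mult_right)
  qed
  finally show "cfrwt_defined \<psi> \<theta> f b a \<longleftrightarrow> \<dots>" .
  have "cfrwt \<psi> \<theta> f b a = (LINT t|lborel. F t)"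
    unfolding cfrwt_def using integral_cong_AE[OF m FL ae] integral_completion[of F lborel] by simp
  also have "\<dots> = \<bar>s\<bar> *\<^sub>R (LINT u|lborel. F (b + s * u))"
    by (rule lborel_integral_real_affine[OF s])
  also have "\<dots> = of_real r * (LINT u|lborel. cnj (\<psi>' u) * f' (b + s * u))"
    unfolding F_aff abs_s using r by (simp add: scaleR_conv_of_real)
  finally show "cfrwt \<psi> \<theta> f b a =
      of_real (\<bar>a\<bar> powr (1 / (2 * \<theta>))) * (LINT u|lborel. cnj (\<psi>' u) * f' (b + s * u))"
    by (simp add: r_def)
qed

lemma AE_cfrwt_defined:
  assumes a: "a \<noteq> 0" and f: "integrable lebesgue f" and \<psi>: "integrable lebesgue \<psi>"
  shows "AE b in lebesgue. cfrwt_defined \<psi> \<theta> f b a"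
proof -
  obtain f' where f': "integrable lborel f'" "AE x in lebesgue. f x = f' x"
    using integrable_lebesgue_ex_lborel[OF f] .
  obtain \<psi>' where \<psi>': "integrable lborel \<psi>'" "AE x in lebesgue. \<psi> x = \<psi>' x"
    using integrable_lebesgue_ex_lborel[OF \<psi>] .
  have "AE b in lborel. integrable lborel (\<lambda>u. cnj (\<psi>' u) * f' (b + sgn a * \<bar>a\<bar> powr (1 / \<theta>) * u))"
    using f' \<psi>' by (intro superposition_integrable) auto
  moreover have "f' \<in> borel_measurable borel" "\<psi>' \<in> borel_measurable borel" "f \<in> borel_measurable lebesgue"
    using f' \<psi>' f by auto
  ultimately show ?thesis
    using cfrwt_superposition(1)[OF a _ _ f'(2) \<psi> _ \<psi>'(2)] by (intro AE_completion) simp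
qed

section \<open>The Hardy space estimate\<close>

lemma normalized_cfrwt_H1:
  fixes \<theta> a :: real and \<psi> \<eta> f :: "real \<Rightarrow> complex"
  defines "K \<equiv> \<bar>a\<bar> powr (1 / (2 * \<theta>)) / sqrt (admissibility_const \<psi> \<theta>) * L1_norm \<psi>"
  assumes a: "a \<noteq> 0" and \<psi>: "integrable lebesgue \<psi>" and \<eta>: "schwartz \<eta>" and f: "f \<in> H1_space \<eta>"
  shows "(\<lambda>b. normalized_cfrwt \<psi> \<theta> f b a) \<in> H1_space \<eta>"
    and "H1_norm \<eta> (\<lambda>b. normalized_cfrwt \<psi> \<theta> f b a) \<le> K * H1_norm \<eta> f"
proof -
  define s where "s = sgn a * \<bar>a\<bar> powr (1 / \<theta>)"
  define \<kappa> where "\<kappa> = \<bar>a\<bar> powr (1 / (2 * \<theta>)) / sqrt (admissibility_const \<psi> \<theta>)"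
  \<comment> \<open>Should the constant have the value 0, division by zero makes
    \<open>\<kappa>\<close> equal to 0, so \<open>\<kappa> \<ge> 0\<close> holds in every
    case.\<close>
  have "admissibility_const \<psi> \<theta> \<ge> 0"
    unfolding admissibility_const_def by (intro integral_nonneg_AE) auto
  then have \<kappa>: "\<kappa> \<ge> 0"
    by (simp add: \<kappa>_def)
  have fint: "integrable lebesgue f" and fin: "(\<integral>\<^sup>+x. maximal_fun \<eta> f x \<partial>lebesgue) < \<infinity>"
    using f by (auto simp: H1_space_def L1_space_def)
  obtain f' where f': "integrable lborel f'" "AE x in lebesgue. f x = f' x"
    using integrable_lebesgue_ex_lborel[OF fint] .
  obtain \<psi>' where \<psi>': "integrable lborel \<psi>'" "AE x in lebesgue. \<psi> x = \<psi>' x"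
    using integrable_lebesgue_ex_lborel[OF \<psi>] .
  define g where "g = (\<lambda>u. cnj (\<psi>' u))"
  have g: "integrable lborel g"
    using \<psi>' by (simp add: g_def)
  have meas: "f' \<in> borel_measurable borel" "\<psi>' \<in> borel_measurable borel" "f \<in> borel_measurable lebesgue"
    using f' \<psi>' fint by auto
  define h where "h = (\<lambda>b. LINT u|lborel. g u * f' (b + s * u))"
  have h: "integrable lborel h"
    unfolding h_def by (rule superposition_integrable[OF f'(1) g])
  have T: "(\<lambda>b. normalized_cfrwt \<psi> \<theta> f b a) = (\<lambda>b. of_real \<kappa> * h b)"
    unfolding normalized_cfrwt_def cfrwt_superposition(2)[OF a meas(3,1) f'(2) \<psi> meas(2) \<psi>'(2)]
    by (simp add: \<kappa>_def h_def g_def s_def)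
  have norm\<psi>: "(LINT u|lborel. cmod (g u)) = L1_norm \<psi>"
  proof -
    have "L1_norm \<psi> = (LINT u|lebesgue. cmod (\<psi>' u))"
      unfolding L1_norm_def
      by (rule integral_cong_AE) (use \<psi> \<psi>' meas(2) in \<open>auto intro!: measurable_completion\<close>)
    also have "\<dots> = (LINT u|lborel. cmod (g u))"
      unfolding g_def complex_mod_cnj using meas(2) by (intro integral_completion) simp
    finally show ?thesis ..
  qed
  have norm_nonneg: "L1_norm \<psi> \<ge> 0"
    by (simp add: L1_norm_def)
  have K: "ennreal K = ennreal \<kappa> * ennreal (L1_norm \<psi>)"
    using ennreal_mult[OF \<kappa> norm_nonneg] by (simp only: K_def \<kappa>_def)
  have [measurable]: "maximal_fun \<eta> h \<in> borel_measurable borel"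
    by (rule borel_measurable_maximal_fun[OF h \<eta>])
  have "(\<integral>\<^sup>+x. maximal_fun \<eta> (\<lambda>b. normalized_cfrwt \<psi> \<theta> f b a) x \<partial>lebesgue) =
      ennreal \<kappa> * (\<integral>\<^sup>+x. maximal_fun \<eta> h x \<partial>lborel)"
    unfolding T maximal_fun_cmult nn_integral_completion
    using \<kappa> by (subst nn_integral_cmult) auto
  also have "\<dots> \<le> ennreal \<kappa> * (ennreal (L1_norm \<psi>) * (\<integral>\<^sup>+x. maximal_fun \<eta> f' x \<partial>lborel))"
    unfolding h_def norm\<psi>[symmetric]
    by (intro mult_left_mono nn_integral_maximal_fun_superposition_le f' g \<eta>) simp
  also have "\<dots> = ennreal K * (\<integral>\<^sup>+x. maximal_fun \<eta> f x \<partial>lebesgue)"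
    unfolding K maximal_fun_cong_AE[OF meas(3,1) f'(2) schwartz_imp_continuous_on[OF \<eta>]]
    by (simp add: nn_integral_completion mult.assoc)
  finally have le: "(\<integral>\<^sup>+x. maximal_fun \<eta> (\<lambda>b. normalized_cfrwt \<psi> \<theta> f b a) x \<partial>lebesgue) \<le> \<dots>" .
  \<comment> \<open>Besides giving membership in the Hardy space, finiteness is what lets
    \<open>le\<close> pass to real numbers: \<open>enn2real\<close> sends infinity to 0 and is
    monotone only below a finite bound.\<close>
  have less: "ennreal K * (\<integral>\<^sup>+x. maximal_fun \<eta> f x \<partial>lebesgue) < \<infinity>"
    using fin by (simp add: ennreal_mult_less_top)
  have "integrable lebesgue h"
    using h integrable_completion[of h lborel] by auto
  then have "integrable lebesgue (\<lambda>b. normalized_cfrwt \<psi> \<theta> f b a)"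
    unfolding T by simp
  then show "(\<lambda>b. normalized_cfrwt \<psi> \<theta> f b a) \<in> H1_space \<eta>"
    using le less by (auto simp: H1_space_def L1_space_def)
  have "H1_norm \<eta> (\<lambda>b. normalized_cfrwt \<psi> \<theta> f b a) \<le>
      enn2real (ennreal K * (\<integral>\<^sup>+x. maximal_fun \<eta> f x \<partial>lebesgue))"
    unfolding H1_norm_def using le less by (intro enn2real_mono) simp_all
  also have "\<dots> = K * H1_norm \<eta> f"
    using mult_nonneg_nonneg[OF \<kappa> norm_nonneg]
    by (simp only: H1_norm_def enn2real_mult K_def \<kappa>_def enn2real_ennreal)
  finally show "H1_norm \<eta> (\<lambda>b. normalized_cfrwt \<psi> \<theta> f b a) \<le> K * H1_norm \<eta> f" .
qed

section \<open>The operator on classes modulo almost everywhere equality\<close>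

text \<open>A Borel representative of \<open>g\<close> also represents \<open>f\<close>, so both
  transforms are given by one and the same integral, at every \<open>b\<close>.\<close>

lemma cfrwt_cong_AE:
  assumes a: "a \<noteq> 0" and f: "integrable lebesgue f" and g: "integrable lebesgue g"
    and \<psi>: "integrable lebesgue \<psi>" and ae: "AE x in lebesgue. f x = g x"
  shows "cfrwt \<psi> \<theta> f b a = cfrwt \<psi> \<theta> g b a"
proof -
  obtain g' where g': "integrable lborel g'" "AE x in lebesgue. g x = g' x"
    using integrable_lebesgue_ex_lborel[OF g] .
  obtain \<psi>' where \<psi>': "integrable lborel \<psi>'" "AE x in lebesgue. \<psi> x = \<psi>' x"
    using integrable_lebesgue_ex_lborel[OF \<psi>] .
  have fg': "AE x in lebesgue. f x = g' x"
    using ae g'(2) by eventually_elim simp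
  have "g' \<in> borel_measurable borel" "\<psi>' \<in> borel_measurable borel"
    "f \<in> borel_measurable lebesgue" "g \<in> borel_measurable lebesgue"
    using g' \<psi>' f g by auto
  then show ?thesis
    by (simp add: cfrwt_superposition(2)[OF a _ _ fg' \<psi> _ \<psi>'(2)]
        cfrwt_superposition(2)[OF a _ _ g'(2) \<psi> _ \<psi>'(2)])
qed

theorem theorem4p1:
  fixes \<theta> a :: real and \<psi> \<eta> :: "real \<Rightarrow> complex"
  assumes "0 < \<theta>" and "\<theta> \<le> 1" and "a \<noteq> 0"
    and "fractional_wavelet \<theta> \<psi>"
    and "schwartz \<eta>" and "(LINT x|lebesgue. \<eta> x) \<noteq> 0"
  shows "(\<forall>f \<in> H1_space \<eta>. AE b in lebesgue. cfrwt_defined \<psi> \<theta> f b a) \<and>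
    bounded_operator_AE (H1_space \<eta>) (H1_norm \<eta>) (H1_space \<eta>) (H1_norm \<eta>)
      (\<lambda>f b. normalized_cfrwt \<psi> \<theta> f b a) \<and>
    (\<forall>f \<in> H1_space \<eta>.
      H1_norm \<eta> (\<lambda>b. normalized_cfrwt \<psi> \<theta> f b a)
        \<le> \<bar>a\<bar> powr (1 / (2 * \<theta>)) / sqrt (admissibility_const \<psi> \<theta>) * L1_norm \<psi> * H1_norm \<eta> f)"
proof -
  have \<psi>: "integrable lebesgue \<psi>"
    using assms(4) by (simp add: fractional_wavelet_def L1_space_def)
  have H1_int: "integrable lebesgue f" if "f \<in> H1_space \<eta>" for f
    using that by (simp add: H1_space_def L1_space_def)
  have def_ae: "AE b in lebesgue. cfrwt_defined \<psi> \<theta> f b a" if "f \<in> H1_space \<eta>" for f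
    using AE_cfrwt_defined[OF assms(3) H1_int[OF that] \<psi>] .
  have cong: "normalized_cfrwt \<psi> \<theta> f b a = normalized_cfrwt \<psi> \<theta> g b a"
    if "f \<in> H1_space \<eta>" "g \<in> H1_space \<eta>" "AE x in lebesgue. f x = g x" for f g b
    using cfrwt_cong_AE[OF assms(3) H1_int[OF that(1)] H1_int[OF that(2)] \<psi> that(3)]
    by (simp add: normalized_cfrwt_def)
  \<comment> \<open>Additivity is claimed where both transforms are defined: the default value 0 of
    a divergent integral is not additive. The exceptional \<open>b\<close> form a null set.\<close>
  have add: "AE b in lebesgue. normalized_cfrwt \<psi> \<theta> (\<lambda>y. f y + g y) b a =
      normalized_cfrwt \<psi> \<theta> f b a + normalized_cfrwt \<psi> \<theta> g b a"
    if "f \<in> H1_space \<eta>" "g \<in> H1_space \<eta>" for f g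
    using def_ae[OF that(1)] def_ae[OF that(2)]
    by eventually_elim
      (simp add: normalized_cfrwt_def cfrwt_def cfrwt_defined_def distrib_left distrib_right)
  \<comment> \<open>In contrast to sums, scalar multiples respect the default value 0, so this
    identity holds at every \<open>b\<close>.\<close>
  have cmult: "normalized_cfrwt \<psi> \<theta> (\<lambda>y. c * f y) b a = c * normalized_cfrwt \<psi> \<theta> f b a" for c f b
    by (simp add: normalized_cfrwt_def cfrwt_def mult.assoc mult.left_commute)
  note H1 = normalized_cfrwt_H1[OF assms(3) \<psi> assms(5)]
  have bound: "\<exists>K. \<forall>f\<in>H1_space \<eta>. H1_norm \<eta> (\<lambda>b. normalized_cfrwt \<psi> \<theta> f b a) \<le> K * H1_norm \<eta> f"
    using H1(2) by (intro exI ballI)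
  have "bounded_operator_AE (H1_space \<eta>) (H1_norm \<eta>) (H1_space \<eta>) (H1_norm \<eta>)
      (\<lambda>f b. normalized_cfrwt \<psi> \<theta> f b a)"
    unfolding bounded_operator_AE_def
    by (intro conjI ballI allI impI bound H1(1) add AE_I2[OF cong] AE_I2[OF cmult])
  then show ?thesis
    by (intro conjI ballI def_ae H1(2))
qed

end
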